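(* Let $n\ge2$. The average output length (over uniformly random $X\in TL_n$) of the Temperley–Lieb factorization algorithm described in the context is $$\overline L_n^{TL}=\frac{(n+1)\left(2^{2n-1}-\binom{2n}{n}\right)}{\binom{2n}{n}}.$$ With the step count $T(X)=2n+2L(X)$, where $L(X)$ is the length of the word returned for $X$, the average runtime $\operatorname{Avg}_n=\frac{1}{|TL_n|}\sum_{X\in TL_n}T(X)$ is $$\operatorname{Avg}_n=\frac{2^{2n}(n+1)}{\binom{2n}{n}}-2\sim\sqrt{\pi}\cdot n^{3/2}\qquad(n\to\infty).$$
   Context: **Temperley–Lieb monoid.** $TL_n$ is the monoid of planar (non-crossing) perfect matchings of the top vertices $1,\dots,n$ and the bottom vertices $1',\dots,n'$ drawn in a rectangle, under stacking of diagrams (discarding closed components). For $1\le i<n$, $e_i$ has the pairs $\{i,i+1\}$, $\{i',(i+1)'\}$ and $\{j,j'\}$ for $j\ne i,i+1$. A cup is a pair of top vertices, a cap a pair of bottom vertices, a transversal pair joins the two rows. **Algorithm.** For $a<b$ let $E(a,b)$ be the list of $e_i$ with $a\le i\le b-1$, $i\equiv a \pmod 2$, and $O(a,b)$ the list of $e_i$ with $a\le i\le b-1$, $i\not\equiv a\pmod 2$, both by increasing $i$. Start with empty lists $F$, top, bot, $B$. For each cup $\{a,b\}$, $a<b$ (by increasing $a$) append $O(a,b)$, then $E(a,b)$, to $F$; for each transversal pair $\{a,c'\}$ with $a<c$ (by increasing $a$) append $E(a,c)$, then $O(a,c)$, to top; for each transversal pair $\{a,c'\}$ with $a>c$ (by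 increasing $a$) append $E(c,a)$, then $O(c,a)$, to bot; for each cap $\{a',b'\}$, $a<b$ (by increasing $a$) append $E(a,b)$, then $O(a,b)$, to $B$. Reverse $F$ and top, and return the concatenation of $F$, top, bot, $B$. Thus $L(X)$ is the sum over all pairs of $X$ of the absolute difference of the two column numbers of the endpoints. $\overline L_n^{TL}=\frac1{|TL_n|}\sum_{X\in TL_n}L(X)$. The symbol $\sim$ means asymptotically equal (ratio tends to $1$). *)

theory Defs
  imports Complex_Main "HOL-Library.Disjoint_Sets" "HOL-Library.Landau_Symbols"
begin

datatype vertex = Top nat | Bot nat

type_synonym diagram = "vertex set set"

definition vertices :: "nat \<Rightarrow> vertex set" where
  "vertices n = Top ` {1..n} \<union> Bot ` {1..n}"

text \<open>
  Position on the boundary of the rectangle, read clockwise: the top row from left to right,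
  followed by the bottom row from right to left.  Two pairs can be joined by disjoint arcs inside
  the rectangle unless their endpoints alternate in this order.
\<close>

fun boundary_pos :: "nat \<Rightarrow> vertex \<Rightarrow> nat" where
  "boundary_pos n (Top i) = i"
| "boundary_pos n (Bot i) = 2 * n + 1 - i"

definition crossing :: "nat \<Rightarrow> vertex set \<Rightarrow> vertex set \<Rightarrow> bool" where
  "crossing n p q \<longleftrightarrow> (\<exists>u v x y. p = {u, v} \<and> q = {x, y} \<and>
     boundary_pos n u < boundary_pos n x \<and>
     boundary_pos n x < boundary_pos n v \<and>
     boundary_pos n v < boundary_pos n y)"

definition perfect_matching :: "nat \<Rightarrow> diagram \<Rightarrow> bool" where
  "perfect_matching n X \<longleftrightarrow> partition_on (vertices n) X \<and> (\<forall>p\<in>X. card p = 2)"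

definition TL :: "nat \<Rightarrow> diagram set" where
  "TL n = {X. perfect_matching n X \<and> (\<forall>p\<in>X. \<forall>q\<in>X. \<not> crossing n p q)}"

definition TL_gen :: "nat \<Rightarrow> nat \<Rightarrow> diagram" where
  "TL_gen n i = {{Top i, Top (i + 1)}, {Bot i, Bot (i + 1)}} \<union>
     (\<lambda>j. {Top j, Bot j}) ` ({1..n} - {i, i + 1})"

definition E_list :: "nat \<Rightarrow> nat \<Rightarrow> nat \<Rightarrow> diagram list" where
  "E_list n a b = map (TL_gen n) (filter (\<lambda>i. i mod 2 = a mod 2) [a..<b])"

definition O_list :: "nat \<Rightarrow> nat \<Rightarrow> nat \<Rightarrow> diagram list" where
  "O_list n a b = map (TL_gen n) (filter (\<lambda>i. i mod 2 \<noteq> a mod 2) [a..<b])"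

text \<open>
  In the following enumerations the outer index is \<open>a\<close>, so the pairs are listed by increasing
  \<open>a\<close>.  In a matching each \<open>a\<close> has at most one partner.
\<close>

definition cups :: "nat \<Rightarrow> diagram \<Rightarrow> (nat \<times> nat) list" where
  "cups n X = [(a, b). a \<leftarrow> [1..<n+1], b \<leftarrow> [1..<n+1], a < b \<and> {Top a, Top b} \<in> X]"

definition caps :: "nat \<Rightarrow> diagram \<Rightarrow> (nat \<times> nat) list" where
  "caps n X = [(a, b). a \<leftarrow> [1..<n+1], b \<leftarrow> [1..<n+1], a < b \<and> {Bot a, Bot b} \<in> X]"

definition transversals :: "nat \<Rightarrow> diagram \<Rightarrow> (nat \<times> nat) list" where
  "transversals n X = [(a, c). a \<leftarrow> [1..<n+1], c \<leftarrow> [1..<n+1], {Top a, Bot c} \<in> X]"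

definition TL_word :: "nat \<Rightarrow> diagram \<Rightarrow> diagram list" where
  "TL_word n X =
    (let F = concat [O_list n a b @ E_list n a b. (a, b) \<leftarrow> cups n X];
         top = concat [E_list n a c @ O_list n a c. (a, c) \<leftarrow> transversals n X, a < c];
         bot = concat [E_list n c a @ O_list n c a. (a, c) \<leftarrow> transversals n X, a > c];
         B = concat [E_list n a b @ O_list n a b. (a, b) \<leftarrow> caps n X]
     in rev F @ rev top @ bot @ B)"

definition TL_length :: "nat \<Rightarrow> diagram \<Rightarrow> nat" where
  "TL_length n X = length (TL_word n X)"

definition TL_steps :: "nat \<Rightarrow> diagram \<Rightarrow> nat" where
  "TL_steps n X = 2 * n + 2 * TL_length n X"

definition avg_length :: "nat \<Rightarrow> real" where
  "avg_length n = (\<Sum>X\<in>TL n. real (TL_length n X)) / real (card (TL n))"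

definition avg_runtime :: "nat \<Rightarrow> real" where
  "avg_runtime n = (\<Sum>X\<in>TL n. real (TL_steps n X)) / real (card (TL n))"

end

theory Submission
  imports Defs "HOL-Analysis.Analysis" "HOL-Real_Asymp.Real_Asymp"
begin

text \<open>
  The number of non-crossing matchings of \<open>2n\<close> boundary points that contain a given pair at boundary
  distance \<open>2k + 1\<close> is \<open>C\<^sub>k C\<^sub>l\<close> (Catalan numbers, \<open>l = n - 1 - k\<close>): the pair separates \<open>2k\<close> points
  from the other \<open>2l\<close>, and both sides are matched independently.  Exchanging the order of summation therefore turns
  the total length into a sum of \<open>C\<^sub>k C\<^sub>l\<close> weighted by the total column distance of all boundary
  pairs at distance \<open>2k + 1\<close>.  Averaged over the symmetry \<open>k \<leftrightarrow> l\<close>, this weight is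
  \<open>2kl + k + l = ((2k + 1)(2l + 1) - 1) / 2\<close>.  As \<open>(2k + 1) C\<^sub>k\<close> is half of a central binomial
  coefficient, the sum is evaluated by the convolution identity of the central binomial coefficients
  (Vandermonde with upper index \<open>-1/2\<close>) and the Catalan recurrence.
\<close>

section \<open>Central binomial coefficients and Catalan numbers\<close>

text \<open>Absorption is applied twice, linked by the equality of the two middle entries of the odd
  row \<open>Suc (2 * n)\<close>.\<close>

lemma central_binomial_Suc:
  "real (Suc n) * real ((2 * Suc n) choose Suc n) = 2 * real (2 * n + 1) * real ((2 * n) choose n)"
proof -
  have a: "Suc n * (Suc (Suc (2 * n)) choose Suc n) = Suc (Suc (2 * n)) * (Suc (2 * n) choose n)"
    by (rule Suc_times_binomial)
  have "Suc (2 * n) choose n = Suc (2 * n) choose Suc n" using central_binomial_odd[of "Suc (2 * n)"] by simp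
  moreover have b: "Suc n * (Suc (2 * n) choose Suc n) = Suc (2 * n) * (2 * n choose n)"
    by (rule Suc_times_binomial)
  ultimately have "Suc n * (Suc n * ((2 * Suc n) choose Suc n)) = Suc n * (2 * (2 * n + 1) * ((2 * n) choose n))"
    using a b by (simp add: algebra_simps)
  then have "Suc n * ((2 * Suc n) choose Suc n) = 2 * (2 * n + 1) * ((2 * n) choose n)"
    by (simp only: mult_cancel_left nat.simps simp_thms)
  then show ?thesis by (metis of_nat_mult of_nat_numeral)
qed

text \<open>Both sides are multiplied by \<open>- (2 * n + 1) / (2 * (n + 1))\<close> in passing
  from \<open>n\<close> to \<open>Suc n\<close>.\<close>

lemma gbinomial_minus_half:
  "((- 1 / 2 :: real) gchoose n) = (- 1 / 4) ^ n * real ((2 * n) choose n)"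
proof (induction n)
  case (Suc n)
  have "real (Suc n) * ((- 1 / 2 :: real) gchoose Suc n) = (- 1 / 2 - real n) * ((- 1 / 2) gchoose n)"
    using gbinomial_mult_1[of "- 1 / 2 :: real" n] by (simp add: algebra_simps)
  also have "\<dots> = (- 1 / 4) ^ Suc n * (2 * real (2 * n + 1) * real ((2 * n) choose n))"
    using Suc by (simp add: field_simps)
  also have "\<dots> = real (Suc n) * ((- 1 / 4) ^ Suc n * real ((2 * Suc n) choose Suc n))"
    by (subst central_binomial_Suc[symmetric]) (simp only: mult_ac)
  finally show ?case by (simp only: mult_cancel_left of_nat_eq_0_iff nat.simps simp_thms)
qed simp

text \<open>In terms of generating functions: the square of (1 - 4x)^(-1/2) is the geometric series
  1/(1 - 4x).\<close>

lemma sum_central_binomial_convolution: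
  "(\<Sum>k\<le>n. real ((2 * k) choose k) * real ((2 * (n - k)) choose (n - k))) = 4 ^ n"
proof -
  have "(- 1 / 4) ^ n * (\<Sum>k\<le>n. real ((2 * k) choose k) * real ((2 * (n - k)) choose (n - k)))
      = (\<Sum>k=0..n. ((- 1 / 2 :: real) gchoose k) * ((- 1 / 2) gchoose (n - k)))"
    unfolding gbinomial_minus_half sum_distrib_left atMost_atLeast0
  proof (intro sum.cong refl)
    fix k assume "k \<in> {0..n}"
    then have "(- 1 / 4 :: real) ^ n = (- 1 / 4) ^ k * (- 1 / 4) ^ (n - k)"
      by (simp flip: power_add)
    then show "(- 1 / 4) ^ n * (real ((2 * k) choose k) * real ((2 * (n - k)) choose (n - k)))
      = (- 1 / 4) ^ k * real ((2 * k) choose k) * ((- 1 / 4) ^ (n - k) * real ((2 * (n - k)) choose (n - k)))"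
      by (simp only: mult_ac)
  qed
  also have "\<dots> = (- 1 :: real) gchoose n" by (simp add: gbinomial_Vandermonde)
  \<comment> \<open>Negating the upper index gives \<open>(- 1) ^ n\<close> times
    \<open>n gchoose n\<close>, and the latter is 1.\<close>
  also have "\<dots> = (- 1) ^ n" using gbinomial_minus[of "1 :: real" n] binomial_gbinomial[of n n, where 'a = real] by simp
  finally have "(- 1 / 4) ^ n * (\<Sum>k\<le>n. real ((2 * k) choose k) * real ((2 * (n - k)) choose (n - k)))
      = (- 1 / 4) ^ n * 4 ^ n" by (simp flip: power_mult_distrib)
  then show ?thesis by (simp only: mult_cancel_left power_eq_0_iff) simp
qed

text \<open>Absorption lowers the upper index from 1/2 to -1/2. The right-hand side is a coefficient
  of (1 - sqrt(1 - 4x))/(2x), the Catalan generating function.\<close>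

lemma central_binomial_div_Suc_eq_gbinomial_half:
  "real ((2 * n) choose n) / real (Suc n) = 2 * (- 4) ^ n * ((1 / 2) gchoose Suc n)"
proof -
  have "real (Suc n) * ((1 / 2) gchoose Suc n) = 1 / 2 * ((- 1 / 2 :: real) gchoose n)"
    using gbinomial_absorption[of n "1 / 2 :: real"] by simp
  also have "\<dots> = 1 / 2 * ((- 1 / 4) ^ n * real ((2 * n) choose n))"
    by (simp only: gbinomial_minus_half)
  finally have "2 * (- 4) ^ n * (real (Suc n) * ((1 / 2) gchoose Suc n)) = ((- 4) * (- 1 / 4)) ^ n * real ((2 * n) choose n)"
    unfolding power_mult_distrib by simp
  then show ?thesis by (simp add: field_simps)
qed

text \<open>The recurrence determines \<open>c\<close>, so it suffices that the closed form obeys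
  it; with upper index 1/2 this is Vandermonde for 1/2 + 1/2 = 1.\<close>

lemma catalan_recurrence_closed_form:
  fixes c :: "nat \<Rightarrow> real"
  assumes "c 0 = 1" and rec: "\<And>n. c (Suc n) = (\<Sum>k\<le>n. c k * c (n - k))"
  shows "c n = real ((2 * n) choose n) / real (Suc n)"
proof (induction n rule: less_induct)
  case (less n)
  show ?case
  proof (cases n)
    case (Suc m)
    let ?g = "\<lambda>k. (1 / 2 :: real) gchoose k"
    have "c n = (\<Sum>k\<le>m. (2 * (- 4) ^ k * ?g (Suc k)) * (2 * (- 4) ^ (m - k) * ?g (Suc (m - k))))"
      unfolding Suc rec
      by (intro sum.cong refl)
         (simp only: less central_binomial_div_Suc_eq_gbinomial_half Suc less_Suc_eq_le atMost_iff diff_le_self)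
    also have "\<dots> = 4 * (- 4) ^ m * (\<Sum>k\<le>m. ?g (Suc k) * ?g (Suc (m - k)))"
      unfolding sum_distrib_left
    proof (intro sum.cong refl)
      fix k assume "k \<in> {..m}"
      then have "(- 4 :: real) ^ m = (- 4) ^ k * (- 4) ^ (m - k)"
        by (simp flip: power_add)
      then show "(2 * (- 4) ^ k * ?g (Suc k)) * (2 * (- 4) ^ (m - k) * ?g (Suc (m - k)))
        = 4 * (- 4) ^ m * (?g (Suc k) * ?g (Suc (m - k)))" by simp
    qed
    also have "(\<Sum>k\<le>m. ?g (Suc k) * ?g (Suc (m - k))) = - 2 * ?g (Suc (Suc m))"
    proof -
      \<comment> \<open>The full convolution is \<open>1 gchoose (m + 2)\<close>, hence 0. Its two
        end terms both equal \<open>?g (Suc (Suc m))\<close>; what remains is the wanted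
        sum.\<close>
      have "0 = (\<Sum>k\<le>Suc (Suc m). ?g k * ?g (Suc (Suc m) - k))"
        using gbinomial_Vandermonde[of "1/2 :: real" "1 / 2" "Suc (Suc m)"] 
          binomial_gbinomial[of 1 "Suc (Suc m)", where 'a = real]
        by (simp add: atMost_atLeast0)
      also have "\<dots> = ?g (Suc (Suc m)) + (\<Sum>k\<le>Suc m. ?g (Suc k) * ?g (Suc m - k))"
        by (subst sum.atMost_Suc_shift) simp
      also have "\<dots> = 2 * ?g (Suc (Suc m)) + (\<Sum>k\<le>m. ?g (Suc k) * ?g (Suc m - k))"
        by simp
      also have "(\<Sum>k\<le>m. ?g (Suc k) * ?g (Suc m - k)) = (\<Sum>k\<le>m. ?g (Suc k) * ?g (Suc (m - k)))"
        by (intro sum.cong refl) (simp add: Suc_diff_le)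
      finally show ?thesis by simp
    qed
    finally show ?thesis
      unfolding central_binomial_div_Suc_eq_gbinomial_half Suc by simp
  qed (use assms in simp)
qed

section \<open>Asymptotics of the central binomial coefficient\<close>

lemma central_binomial_asymp_equiv:
  "(\<lambda>n. real ((2 * n) choose n)) \<sim>[at_top] (\<lambda>n. 4 ^ n / sqrt (pi * real n))"
proof (rule asymp_equivI')
  \<comment> \<open>The limit \<open>inverse (Gamma (1 / 2))\<close> is \<open>1 / sqrt pi\<close>,
    so a factor \<open>sqrt pi\<close> normalises it to 1.\<close>
  have "(\<lambda>n. ((- 1 / 2 :: real) gchoose n) / ((- 1) ^ n / exp ((- 1 / 2 + 1) * of_real (ln (real n)))))
          \<longlonglongrightarrow> inverse (Gamma (- (- 1 / 2)))"
    by (rule gbinomial_asymptotic)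
  then have "(\<lambda>n. ((- 1 / 2 :: real) gchoose n) / ((- 1) ^ n / exp ((- 1 / 2 + 1) * of_real (ln (real n)))) * sqrt pi)
          \<longlonglongrightarrow> inverse (Gamma (- (- 1 / 2))) * sqrt pi"
    by (intro tendsto_intros)
  then have *: "(\<lambda>n. ((- 1 / 2 :: real) gchoose n) / ((- 1) ^ n / exp ((- 1 / 2 + 1) * of_real (ln (real n)))) * sqrt pi)
          \<longlonglongrightarrow> 1"
    by (simp add: Gamma_one_half_real)
  show "(\<lambda>n. real ((2 * n) choose n) / (4 ^ n / sqrt (pi * real n))) \<longlonglongrightarrow> 1"
  proof (rule Lim_transform_eventually[OF *])
    show "\<forall>\<^sub>F n in sequentially. ((- 1 / 2 :: real) gchoose n) / ((- 1) ^ n / exp ((- 1 / 2 + 1) * of_real (ln (real n)))) * sqrt pi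
       = real ((2 * n) choose n) / (4 ^ n / sqrt (pi * real n))"
      using eventually_gt_at_top[of "0::nat"]
    proof eventually_elim
      case (elim n)
      have "exp ((- 1 / 2 + 1) * of_real (ln (real n))) = real n powr (1 / 2)"
        using elim by (simp add: powr_def)
      also have "\<dots> = sqrt (real n)" using elim by (simp add: powr_half_sqrt)
      moreover have "(- 1 / 4 :: real) ^ n = (- 1) ^ n / 4 ^ n" by (rule power_divide)
      ultimately show ?case
        by (simp only: gbinomial_minus_half) (simp add: real_sqrt_mult)
    qed
  qed
qed

section \<open>Non-crossing matchings\<close>

text \<open>Quantifying over members lets crossings be transported along maps. Only one of the two
  alternation orders is covered; \<open>nc_matchings\<close> takes \<open>p\<close> and
  \<open>q\<close> in both orders.\<close>

definition crosses :: "('a \<Rightarrow> nat) \<Rightarrow> 'a set \<Rightarrow> 'a set \<Rightarrow> bool" where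
  "crosses f p q \<longleftrightarrow> (\<exists>u\<in>p. \<exists>v\<in>p. \<exists>x\<in>q. \<exists>y\<in>q. f u < f x \<and> f x < f v \<and> f v < f y)"

text \<open>An arbitrary point set ordered by \<open>f\<close> is allowed, so that the points on
  either side of a chosen pair again form an instance.\<close>

definition nc_matchings :: "('a \<Rightarrow> nat) \<Rightarrow> 'a set \<Rightarrow> 'a set set set" where
  "nc_matchings f V =
     {X. partition_on V X \<and> (\<forall>p\<in>X. card p = 2) \<and> (\<forall>p\<in>X. \<forall>q\<in>X. \<not> crosses f p q)}"

definition nc_count :: "nat \<Rightarrow> nat" where
  "nc_count m = card (nc_matchings id {..<m})"

lemma finite_nc_matchings: "finite V \<Longrightarrow> finite (nc_matchings f V)"
  by (rule finite_subset[of _ "Pow (Pow V)"]) (auto simp: nc_matchings_def partition_on_def)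

lemma card_nc_matchings_odd:
  assumes "finite V" "odd (card V)"
  shows "card (nc_matchings f V) = 0"
proof -
  have "even (card V)" if "X \<in> nc_matchings f V" for X
  proof -
    have X: "partition_on V X" "\<forall>p\<in>X. card p = 2" using that by (auto simp: nc_matchings_def)
    have "card V = (\<Sum>p\<in>X. card p)"
      by (rule product_partition[OF X(1)]) (use X(2) card.infinite in fastforce)
    also have "\<dots> = 2 * card X" using X(2) by simp
    finally show ?thesis by simp
  qed
  then have "nc_matchings f V = {}" using assms(2) by auto
  then show ?thesis by simp
qed

text \<open>It is enough that \<open>g\<close> reflects the order: a crossing between images then
  pulls back to a crossing between the original blocks.\<close>

lemma image_nc_matchings:
  assumes inj: "inj_on g A"
    and mono: "\<And>x y. x \<in> A \<Longrightarrow> y \<in> A \<Longrightarrow> f' (g x) < f' (g y) \<Longrightarrow> f x < f y"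
    and X: "X \<in> nc_matchings f A"
  shows "(`) g ` X \<in> nc_matchings f' (g ` A)"
proof -
  have P: "partition_on A X" "\<And>p. p \<in> X \<Longrightarrow> card p = 2"
    "\<And>p q. p \<in> X \<Longrightarrow> q \<in> X \<Longrightarrow> \<not> crosses f p q"
    using X by (auto simp: nc_matchings_def)
  have sub: "p \<subseteq> A" if "p \<in> X" for p using P(1) that by (auto simp: partition_on_def)
  have "partition_on (g ` A) ((`) g ` X - {{}})"
    by (rule partition_on_inj_image[OF P(1) inj]) 
  moreover have "(`) g ` X - {{}} = (`) g ` X" using partition_onD3[OF P(1)] by auto
  moreover have "card (g ` p) = 2" if "p \<in> X" for p
    using P(2)[OF that] sub[OF that] inj by (metis card_image inj_on_subset)
  moreover have "\<not> crosses f' (g ` p) (g ` q)" if "p \<in> X" "q \<in> X" for p q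
    using P(3)[OF that] sub[OF that(1)] sub[OF that(2)] mono unfolding crosses_def by blast
  ultimately show ?thesis by (auto simp: nc_matchings_def)
qed

lemma card_nc_matchings_le:
  assumes "bij_betw g A B" "finite B"
    and "\<And>x y. x \<in> A \<Longrightarrow> y \<in> A \<Longrightarrow> f' (g x) < f' (g y) \<Longrightarrow> f x < f y"
  shows "card (nc_matchings f A) \<le> card (nc_matchings f' B)"
proof (rule card_inj_on_le)
  have inj: "inj_on g A" and B: "g ` A = B" using assms(1) by (auto simp: bij_betw_def)
  have "inj_on ((`) ((`) g)) (Pow (Pow A))" by (intro inj_on_image_Pow inj)
  then show "inj_on ((`) ((`) g)) (nc_matchings f A)"
    by (rule inj_on_subset) (auto simp: nc_matchings_def partition_on_def)
  show "(`) ((`) g) ` nc_matchings f A \<subseteq> nc_matchings f' B"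
    using image_nc_matchings[OF inj, of f' f] assms(3) unfolding B[symmetric] by blast
qed (rule finite_nc_matchings[OF assms(2)])

text \<open>Only the order of the positions matters, and listing \<open>V\<close> by increasing
  position identifies it with \<open>{..<card V}\<close>. The bound by an injection is used in both
  directions.\<close>

lemma card_nc_matchings:
  assumes fin: "finite V" and inj: "inj_on f V"
  shows "card (nc_matchings f V) = nc_count (card V)"
proof -
  have "card (f ` V) = card V" by (rule card_image[OF inj])
  then obtain h where h: "bij_betw h {..<card V} (f ` V)" "strict_mono_on {..<card V} h"
    using ex_bij_betw_strict_mono_card[of "f ` V"] fin by (metis finite_imageI)
  \<comment> \<open>\<open>g i\<close> is the point of \<open>V\<close> with the \<open>i\<close>-th
    smallest position, counted from 0.\<close>
  define g where "g = inv_into V f \<circ> h"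
  have g: "bij_betw g {..<card V} V"
    unfolding g_def using inj by (intro bij_betw_trans[OF h(1)] bij_betw_inv_into) (simp add: bij_betw_def)
  have fg: "f (g i) = h i" if "i < card V" for i
    using that bij_betwE[OF h(1)] by (simp add: g_def f_inv_into_f)
  have lt: "f (g i) < f (g j) \<longleftrightarrow> i < j" if "i < card V" "j < card V" for i j
    using that h(2) by (simp add: fg strict_mono_on_less)
  show ?thesis unfolding nc_count_def
  proof (rule antisym)
    show "card (nc_matchings id {..<card V}) \<le> card (nc_matchings f V)"
      by (rule card_nc_matchings_le[OF g fin]) (use lt in auto)
    define k where "k = inv_into {..<card V} g"
    have k: "bij_betw k V {..<card V}" unfolding k_def by (rule bij_betw_inv_into[OF g])
    have "k x < card V" "g (k x) = x" if "x \<in> V" for x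
      using bij_betwE[OF k] bij_betw_inv_into_right[OF g] that by (auto simp: k_def)
    then have "f x < f y" if "x \<in> V" "y \<in> V" "k x < k y" for x y
      using lt[of "k x" "k y"] that by simp
    then show "card (nc_matchings f V) \<le> card (nc_matchings id {..<card V})"
      by (intro card_nc_matchings_le[OF k]) auto
  qed
qed

text \<open>A block with one end in \<open>I\<close> and the other in \<open>J\<close> would cross
  \<open>{u, v}\<close>, so the remaining blocks split into a matching of \<open>I\<close> and one
  of \<open>J\<close>. Conversely any two such matchings combine, as blocks on different sides
  cannot alternate.\<close>

lemma card_nc_matchings_containing:
  assumes fin: "finite V" and inj: "inj_on f V" and uv: "u \<in> V" "v \<in> V" "f u < f v"
  defines "I \<equiv> {w \<in> V. f u < f w \<and> f w < f v}"
    and "J \<equiv> {w \<in> V. f w < f u \<or> f v < f w}"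
  shows "card {X \<in> nc_matchings f V. {u, v} \<in> X} = nc_count (card I) * nc_count (card J)"
proof -
  have "w = u \<or> w = v \<or> w \<in> I \<union> J" if "w \<in> V" for w
    using that uv inj_onD[OF inj, of w u] inj_onD[OF inj, of w v] linorder_less_linear[of "f w" "f u"]
      linorder_less_linear[of "f w" "f v"] by (auto simp: I_def J_def)
  moreover have "I \<subseteq> V" "J \<subseteq> V" by (auto simp: I_def J_def)
  ultimately have V: "V = {u, v} \<union> (I \<union> J)" using uv(1,2) by blast
  have disj: "I \<inter> J = {}" "u \<notin> I" "v \<notin> I" "u \<notin> J" "v \<notin> J"
    using uv(3) by (auto simp: I_def J_def)
  have neq: "u \<noteq> v" using uv by auto
  have "bij_betw (\<lambda>(Y, Z). insert {u, v} (Y \<union> Z)) (nc_matchings f I \<times> nc_matchings f J)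
          {X \<in> nc_matchings f V. {u, v} \<in> X}"
  proof (rule bij_betw_byWitness[where f' = "\<lambda>X. (X \<inter> Pow I, X \<inter> Pow J)"])
    have part: "Y \<subseteq> Pow A \<and> {} \<notin> Y" if "Y \<in> nc_matchings f A" for A Y
      using that by (auto simp: nc_matchings_def partition_on_def)
    show "\<forall>a\<in>nc_matchings f I \<times> nc_matchings f J.
       (\<lambda>X. (X \<inter> Pow I, X \<inter> Pow J)) ((\<lambda>(Y, Z). insert {u, v} (Y \<union> Z)) a) = a"
    proof clarify
      fix Y Z assume "Y \<in> nc_matchings f I" "Z \<in> nc_matchings f J"
      then have YZ: "Y \<subseteq> Pow I" "{} \<notin> Y" "Z \<subseteq> Pow J" "{} \<notin> Z" 
        using part[of Y I] part[of Z J] by blast+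
      \<comment> \<open>The empty set lies in both \<open>Pow I\<close> and \<open>Pow J\<close>;
        the absence of empty blocks makes the two halves recoverable.\<close>
      have "p \<notin> Pow J" if "p \<in> Y" for p
      proof
        assume "p \<in> Pow J"
        moreover have "p \<in> Pow I" by (rule subsetD[OF YZ(1) that])
        ultimately have "p \<subseteq> I \<inter> J" by simp
        then show False using that YZ(2) unfolding disj(1) by simp
      qed
      moreover have "p \<notin> Pow I" if "p \<in> Z" for p
      proof
        assume "p \<in> Pow I"
        moreover have "p \<in> Pow J" by (rule subsetD[OF YZ(3) that])
        ultimately have "p \<subseteq> I \<inter> J" by simp
        then show False using that YZ(4) unfolding disj(1) by simp
      qed
      ultimately have "Y \<inter> Pow J = {}" "Z \<inter> Pow I = {}"
        by (simp_all only: disjoint_iff) simp_all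
      moreover have "{u, v} \<notin> Pow I" "{u, v} \<notin> Pow J" using disj by auto
      ultimately show "insert {u, v} (Y \<union> Z) \<inter> Pow I = Y \<and> insert {u, v} (Y \<union> Z) \<inter> Pow J = Z"
        using YZ(1,3) by (simp only: Int_insert_left Int_Un_distrib2 if_False Int_absorb2 Un_empty_left Un_empty_right simp_thms)
    qed
    have split: "p = {u, v} \<or> p \<subseteq> I \<or> p \<subseteq> J"
      if X: "X \<in> nc_matchings f V" "{u, v} \<in> X" and p: "p \<in> X" for X p
    proof (cases "p = {u, v}")
      case False
      have "p \<inter> {u, v} = {}" "p \<subseteq> V"
        using X p False by (auto simp: nc_matchings_def partition_on_def disjoint_def)
      moreover have "card p = 2" "\<not> crosses f {u, v} p" "\<not> crosses f p {u, v}"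
        using X p by (auto simp: nc_matchings_def)
      moreover obtain x y where "p = {x, y}" using \<open>card p = 2\<close> by (meson card_2_iff)
      ultimately have x: "x \<in> I \<union> J" "y \<in> I \<union> J"
        and nc: "\<not> crosses f {u, v} {x, y}" "\<not> crosses f {x, y} {u, v}" and p: "p = {x, y}"
        using V by auto
      have False if ab: "p = {a, b}" "a \<in> I" "b \<in> J" for a b
      proof -
        \<comment> \<open>\<open>b\<close> lies before \<open>u\<close> or after \<open>v\<close>:
          in the first case \<open>p\<close> crosses \<open>{u, v}\<close>, in the second
          \<open>{u, v}\<close> crosses \<open>p\<close>.\<close>
        have "f b < f u \<and> f u < f a \<and> f a < f v \<or> f u < f a \<and> f a < f v \<and> f v < f b"
          using ab(2,3) by (auto simp: I_def J_def)
        then have "crosses f {u, v} p \<or> crosses f p {u, v}"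
          unfolding ab(1) crosses_def by blast
        then show False using nc p by simp
      qed
      from this[of x y] this[of y x] show ?thesis using x p by auto
    qed auto
    show "\<forall>X\<in>{X \<in> nc_matchings f V. {u, v} \<in> X}.
       (\<lambda>(Y, Z). insert {u, v} (Y \<union> Z)) (X \<inter> Pow I, X \<inter> Pow J) = X"
      using split by auto
    show "(\<lambda>(Y, Z). insert {u, v} (Y \<union> Z)) ` (nc_matchings f I \<times> nc_matchings f J)
       \<subseteq> {X \<in> nc_matchings f V. {u, v} \<in> X}"
    proof clarify
      fix Y Z assume Y: "Y \<in> nc_matchings f I" and Z: "Z \<in> nc_matchings f J"
      have P: "partition_on I Y" "partition_on J Z" using Y Z by (auto simp: nc_matchings_def)
      have un: "\<Union>Y = I" "\<Union>Z = J" using P by (auto simp: partition_on_def)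
      have "partition_on (I \<union> J) (Y \<union> Z)"
        using P un disj(1) by (auto simp: partition_on_def intro!: disjoint_union)
      moreover have "V - {u, v} = I \<union> J" using V disj by auto
      ultimately have 1: "partition_on V (insert {u, v} (Y \<union> Z))"
        using un disj uv by (subst partition_on_insert) (auto simp: disjnt_def)
      have nc: "\<not> crosses f p q" if "p \<in> insert {u, v} (Y \<union> Z)" "q \<in> insert {u, v} (Y \<union> Z)" for p q
      proof -
        have cases: "p = {u,v} \<or> (p \<in> Y \<and> p \<subseteq> I) \<or> (p \<in> Z \<and> p \<subseteq> J)"
             "q = {u,v} \<or> (q \<in> Y \<and> q \<subseteq> I) \<or> (q \<in> Z \<and> q \<subseteq> J)"
          using that un by auto
        have lt: "f u < f w" "f w < f v" if "w \<in> I" for w using that by (auto simp: I_def)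
        have gt: "f w < f u \<or> f v < f w" if "w \<in> J" for w using that by (auto simp: J_def)
        have YY: "\<not> crosses f p q" if "p \<in> Y" "q \<in> Y" using Y that by (auto simp: nc_matchings_def)
        have ZZ: "\<not> crosses f p q" if "p \<in> Z" "q \<in> Z" using Z that by (auto simp: nc_matchings_def)
        \<comment> \<open>No point outside \<open>I\<close> lies strictly between \<open>u\<close>
          and \<open>v\<close>. In each of the four cases below a crossing would produce such a
          point, trapped between two points of \<open>I\<close> or between \<open>u\<close> and
          \<open>v\<close>.\<close>
        have between: False if "w \<in> insert u (insert v J)" "f u < f w" "f w < f v" for w
          using that gt[of w] by auto
        have IJ: "\<not> crosses f p q" if A: "p \<subseteq> I" and B: "q \<subseteq> insert u (insert v J)"
        proof
          assume "crosses f p q"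
          then obtain a b x where "a \<in> I" "b \<in> I" "x \<in> q" "f a < f x" "f x < f b"
            using A unfolding crosses_def by blast
          then show False using subsetD[OF B, of x] between[of x] lt[of a] lt[of b] uv(3) by auto
        qed
        have JI: "\<not> crosses f p q" if A: "q \<subseteq> I" and B: "p \<subseteq> insert u (insert v J)"
        proof
          assume "crosses f p q"
          then obtain a b x where "a \<in> I" "b \<in> I" "x \<in> p" "f a < f x" "f x < f b"
            using A unfolding crosses_def by blast
          then show False using subsetD[OF B, of x] between[of x] lt[of a] lt[of b] uv(3) by auto
        qed
        have uvJ: "\<not> crosses f p q" if A: "p = {u, v}" and B: "q \<subseteq> insert u (insert v J)"
        proof
          assume "crosses f p q"
          then obtain a b x where "a \<in> {u, v}" "b \<in> {u, v}" "x \<in> q" "f a < f x" "f x < f b"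
            using A unfolding crosses_def by blast
          then show False using subsetD[OF B, of x] between[of x] lt[of a] lt[of b] uv(3) by auto
        qed
        have Juv: "\<not> crosses f p q" if A: "q = {u, v}" and B: "p \<subseteq> insert u (insert v J)"
        proof
          assume "crosses f p q"
          then obtain a b x where "a \<in> {u, v}" "b \<in> {u, v}" "x \<in> p" "f a < f x" "f x < f b"
            using A unfolding crosses_def by blast
          then show False using subsetD[OF B, of x] between[of x] lt[of a] lt[of b] uv(3) by auto
        qed
        show ?thesis using cases YY ZZ IJ JI uvJ Juv by auto
      qed
      have "\<forall>p\<in>insert {u, v} (Y \<union> Z). card p = 2"
        using Y Z neq by (auto simp: nc_matchings_def)
      with 1 nc show "insert {u, v} (Y \<union> Z) \<in> nc_matchings f V \<and> {u, v} \<in> insert {u, v} (Y \<union> Z)"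
        by (auto simp: nc_matchings_def)
    qed
    show "(\<lambda>X. (X \<inter> Pow I, X \<inter> Pow J)) ` {X \<in> nc_matchings f V. {u, v} \<in> X}
       \<subseteq> nc_matchings f I \<times> nc_matchings f J"
    proof clarify
      fix X assume X: "X \<in> nc_matchings f V" "{u, v} \<in> X"
      have P: "partition_on V X" using X by (auto simp: nc_matchings_def)
      have "partition_on A (X \<inter> Pow A)" if A: "A = I \<or> A = J" for A
      proof (rule partition_onI)
        show "\<Union>(X \<inter> Pow A) = A"
        proof (intro equalityI subsetI)
          fix w assume w: "w \<in> A"
          \<comment> \<open>The block through \<open>w\<close> is neither \<open>{u, v}\<close> nor
            on the other side, so \<open>split\<close> places it inside \<open>A\<close>.\<close>
          then obtain p where "p \<in> X" "w \<in> p" using A V partition_onD1[OF P] by blast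
          then show "w \<in> \<Union>(X \<inter> Pow A)" using split[OF X \<open>p \<in> X\<close>] w A disj by auto
        qed auto
      qed (use P in \<open>auto simp: partition_on_def disjoint_def disjnt_def\<close>)
      then show "X \<inter> Pow I \<in> nc_matchings f I \<and> X \<inter> Pow J \<in> nc_matchings f J"
        using X(1) by (auto simp: nc_matchings_def)
    qed
  qed
  then have "card {X \<in> nc_matchings f V. {u, v} \<in> X}
      = card (nc_matchings f I) * card (nc_matchings f J)"
    by (simp add: bij_betw_same_card[symmetric] card_cartesian_product)
  also have "\<dots> = nc_count (card I) * nc_count (card J)"
    using fin inj by (subst (1 2) card_nc_matchings) (auto simp: I_def J_def intro: inj_on_subset)
  finally show ?thesis .
qed

section \<open>Counting diagrams and their pairs\<close>

lemma nc_count_0: "nc_count 0 = 1"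
proof -
  have "nc_matchings id ({} :: nat set) = {{}}" by (auto simp: nc_matchings_def partition_on_empty)
  then show ?thesis by (simp add: nc_count_def)
qed

lemma nc_count_odd: "odd m \<Longrightarrow> nc_count m = 0"
  unfolding nc_count_def by (rule card_nc_matchings_odd) auto

lemma sum_nat_odd:
  fixes h :: "nat \<Rightarrow> 'a::comm_monoid_add"
  assumes "\<And>d. even d \<Longrightarrow> h d = 0"
  shows "(\<Sum>d<2 * m. h d) = (\<Sum>k<m. h (2 * k + 1))"
  by (induction m) (simp_all add: assms)

text \<open>Matchings are classified by the partner \<open>v\<close> of the point 0, which leaves
  \<open>v - 1\<close> points between 0 and \<open>v\<close> and \<open>2 * Suc n - 1 - v\<close>
  beyond \<open>v\<close>.\<close>

lemma nc_count_rec: "nc_count (2 * Suc n) = (\<Sum>k\<le>n. nc_count (2 * k) * nc_count (2 * (n - k)))"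
proof -
  let ?V = "{..<2 * Suc n}"
  let ?A = "\<lambda>v. {X \<in> nc_matchings id ?V. {0, v} \<in> X}"
  have "nc_matchings id ?V = (\<Union>v\<in>{1..<2 * Suc n}. ?A v)"
  proof -
    have "\<exists>v\<in>{1..<2 * Suc n}. {0, v} \<in> X" if X: "X \<in> nc_matchings id ?V" for X
    proof -
      have P: "\<Union>X = ?V" using X by (simp add: nc_matchings_def partition_on_def)
      moreover have "0 \<in> ?V" by simp
      ultimately obtain p where p: "p \<in> X" "0 \<in> p" by blast
      then have "card p = 2" using X by (auto simp: nc_matchings_def)
      then obtain v where v: "p = {0, v}" "v \<noteq> 0" using p(2) by (auto simp: card_2_iff)
      then show ?thesis using p P by (intro bexI[of _ v]) auto
    qed
    then show ?thesis by blast
  qed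
  then have "nc_count (2 * Suc n) = card (\<Union>v\<in>{1..<2 * Suc n}. ?A v)"
    by (simp only: nc_count_def)
  also have "\<dots> = (\<Sum>v=1..<2 * Suc n. card (?A v))"
  proof (rule card_UN_disjoint)
    have "v = w" if "X \<in> nc_matchings id ?V" "{0, v} \<in> X" "{0, w} \<in> X" "v \<noteq> 0" for X v w
    proof -
      have "disjoint X" using that(1) by (simp add: nc_matchings_def partition_on_def)
      then have "{0, v} = {0, w}"
        using disjointD[of X "{0, v}" "{0, w}"] that(2,3) by (metis disjoint_iff insertI1)
      then show ?thesis using that(4) by (auto simp: doubleton_eq_iff)
    qed
    then show "\<forall>v\<in>{1..<2 * Suc n}. \<forall>w\<in>{1..<2 * Suc n}. v \<noteq> w \<longrightarrow> ?A v \<inter> ?A w = {}"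
      by fastforce
  qed (auto simp: finite_nc_matchings)
  also have "\<dots> = (\<Sum>v=1..<2 * Suc n. nc_count (v - 1) * nc_count (2 * Suc n - 1 - v))"
  proof (rule sum.cong)
    fix v assume v: "v \<in> {1..<2 * Suc n}"
    have "{w \<in> ?V. id 0 < id w \<and> id w < id v} = {1..<v}"
      "{w \<in> ?V. id w < id 0 \<or> id v < id w} = {Suc v..<2 * Suc n}"
      using v by auto
    moreover have "card (?A v) = nc_count (card {w \<in> ?V. id 0 < id w \<and> id w < id v})
        * nc_count (card {w \<in> ?V. id w < id 0 \<or> id v < id w})"
      using v by (intro card_nc_matchings_containing) auto
    ultimately show "card (?A v) = nc_count (v - 1) * nc_count (2 * Suc n - 1 - v)"
      by (simp only: card_atLeastLessThan) simp
  qed simp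
  \<comment> \<open>A positive even \<open>v\<close> encloses an odd number of points and
    contributes nothing; the added index 0 is even and gets the value 0.\<close>
  also have "\<dots> = (\<Sum>v<2 * Suc n. if odd v then nc_count (v - 1) * nc_count (2 * Suc n - 1 - v) else 0)"
    by (rule sum.mono_neutral_cong_left) (auto simp: nc_count_odd not_less_eq_eq)
  also have "\<dots> = (\<Sum>k<Suc n. nc_count (2 * k) * nc_count (2 * (n - k)))"
    by (subst sum_nat_odd) (auto intro!: sum.cong simp: diff_mult_distrib2)
  finally show ?thesis by (simp only: lessThan_Suc_atMost)
qed

lemma nc_count_even: "real (nc_count (2 * n)) = real ((2 * n) choose n) / real (Suc n)"
  by (rule catalan_recurrence_closed_form[where c = "\<lambda>k. real (nc_count (2 * k))"])
     (simp_all only: nc_count_0 nc_count_rec of_nat_sum of_nat_mult mult_0_right of_nat_1)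

section \<open>Diagrams as non-crossing matchings of the boundary\<close>

lemma inj_on_boundary_pos: "inj_on (boundary_pos n) (vertices n)"
  by (auto simp: inj_on_def vertices_def)

lemma boundary_pos_image: "boundary_pos n ` vertices n = {1..2 * n}"
proof -
  have "(\<lambda>i. 2 * n + 1 - i) ` {1..n} = {n + 1..2 * n}"
  proof (intro equalityI subsetI)
    fix x assume "x \<in> {n + 1..2 * n}"
    then show "x \<in> (\<lambda>i. 2 * n + 1 - i) ` {1..n}" by (intro image_eqI[of _ _ "2 * n + 1 - x"]) auto
  qed auto
  then have "boundary_pos n ` vertices n = {1..n} \<union> {n + 1..2 * n}"
    by (simp add: vertices_def image_Un image_image)
  then show ?thesis by auto
qed

lemma finite_vertices: "finite (vertices n)" by (simp add: vertices_def)

lemma card_vertices_between: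
  "card {w \<in> vertices n. P (boundary_pos n w)} = card {i \<in> {1..2 * n}. P i}"
proof -
  have "{i \<in> {1..2 * n}. P i} = boundary_pos n ` {w \<in> vertices n. P (boundary_pos n w)}"
    unfolding boundary_pos_image[symmetric] by auto
  then show ?thesis
    by (simp only:) (rule card_image[symmetric], rule inj_on_subset[OF inj_on_boundary_pos], auto)
qed

text \<open>On two-element blocks both notions of crossing coincide: the strict inequalities make
  the two chosen members of each block distinct, so they exhaust it.\<close>

lemma TL_eq_nc_matchings: "TL n = nc_matchings (boundary_pos n) (vertices n)"
proof -
  have "crossing n p q \<longleftrightarrow> crosses (boundary_pos n) p q" if pq: "card p = 2" "card q = 2" for p q
  proof
    assume "crosses (boundary_pos n) p q"
    then obtain u v x y where *: "u \<in> p" "v \<in> p" "x \<in> q" "y \<in> q"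
      "boundary_pos n u < boundary_pos n x" "boundary_pos n x < boundary_pos n v"
      "boundary_pos n v < boundary_pos n y" unfolding crosses_def by blast
    then have "u \<noteq> v" "x \<noteq> y" by auto
    then have "p = {u, v}" "q = {x, y}" using * pq by (auto simp: card_2_iff)
    then show "crossing n p q" unfolding crossing_def using * by blast
  qed (auto simp: crossing_def crosses_def)
  then show ?thesis unfolding TL_def nc_matchings_def perfect_matching_def by auto
qed

lemma finite_TL: "finite (TL n)"
  by (simp add: TL_eq_nc_matchings finite_nc_matchings finite_vertices)

lemma card_TL: "card (TL n) = nc_count (2 * n)"
  using card_image[OF inj_on_boundary_pos[of n]] boundary_pos_image[of n]
  by (simp add: TL_eq_nc_matchings card_nc_matchings finite_vertices inj_on_boundary_pos)

text \<open>Here \<open>d\<close> is a boundary distance. A positive even \<open>d\<close> encloses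
  an odd number of points, so no matching contains such a pair.\<close>

definition pair_count :: "nat \<Rightarrow> nat \<Rightarrow> nat" where
  "pair_count n d = (if odd d then nc_count (d - 1) * nc_count (2 * n - 1 - d) else 0)"

text \<open>The numbers of points inside and outside the pair depend only on the difference of the
  two positions.\<close>

lemma card_TL_containing:
  assumes "u \<in> vertices n" "v \<in> vertices n" "boundary_pos n u < boundary_pos n v"
  shows "card {X \<in> TL n. {u, v} \<in> X} = pair_count n (boundary_pos n v - boundary_pos n u)"
proof -
  let ?p = "boundary_pos n u" and ?q = "boundary_pos n v"
  have b: "?p \<in> {1..2 * n}" "?q \<in> {1..2 * n}" using assms boundary_pos_image by blast+
  have "{i \<in> {1..2 * n}. ?p < i \<and> i < ?q} = {Suc ?p..<?q}" using b by auto
  then have I: "card {w \<in> vertices n. ?p < boundary_pos n w \<and> boundary_pos n w < ?q} = ?q - ?p - 1"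
    using card_vertices_between[of n "\<lambda>i. ?p < i \<and> i < ?q"] by simp
  have "{i \<in> {1..2 * n}. i < ?p \<or> ?q < i} = {1..<?p} \<union> {Suc ?q..<Suc (2 * n)}" using assms(3) b by auto
  moreover have "card ({1..<?p} \<union> {Suc ?q..<Suc (2 * n)}) = (?p - 1) + (2 * n - ?q)"
    using assms(3) by (subst card_Un_disjoint) auto
  ultimately have J: "card {w \<in> vertices n. boundary_pos n w < ?p \<or> ?q < boundary_pos n w}
      = 2 * n - 1 - (?q - ?p)"
    using card_vertices_between[of n "\<lambda>i. i < ?p \<or> ?q < i"] b assms(3) by simp
  have "card {X \<in> TL n. {u, v} \<in> X} = nc_count (?q - ?p - 1) * nc_count (2 * n - 1 - (?q - ?p))"
    unfolding TL_eq_nc_matchings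
    using card_nc_matchings_containing[OF finite_vertices inj_on_boundary_pos assms] I J by simp
  then show ?thesis using assms(3) by (auto simp: pair_count_def nc_count_odd)
qed

section \<open>Word length as a sum of column distances\<close>

lemma length_E_list_O_list: "length (E_list n a b) + length (O_list n a b) = b - a"
  using sum_length_filter_compl[of "\<lambda>i. i mod 2 = a mod 2" "[a..<b]"]
  by (simp add: E_list_def O_list_def)

lemma sum_list_pairs:
  fixes g :: "nat \<Rightarrow> nat \<Rightarrow> nat"
  shows "sum_list (map (\<lambda>(a, b). g a b) [(a, b). a \<leftarrow> [1..<n+1], b \<leftarrow> [1..<n+1], P a b])
    = (\<Sum>a=1..n. \<Sum>b=1..n. if P a b then g a b else 0)"
proof -
  have "sum_list (map g (concat xss)) = sum_list (map (\<lambda>xs. sum_list (map g xs)) xss)"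
    for g :: "nat \<times> nat \<Rightarrow> nat" and xss
    by (induction xss) auto
  moreover have "sum_list (map h [1..<n+1]) = (\<Sum>a=1..n. h a)" for h :: "nat \<Rightarrow> nat"
    by (simp only: interv_sum_list_conv_sum_set_nat set_upt) (rule sum.cong, auto)
  moreover have "sum_list (map g (if c then [x] else [])) = (if c then g x else 0)"
    for g :: "nat \<times> nat \<Rightarrow> nat" and c x by simp
  ultimately show ?thesis by (simp only: map_map o_def prod.case)
qed

text \<open>The truncated differences \<open>a - c\<close> and \<open>c - a\<close> come from the
  lists \<open>bot\<close> and \<open>top\<close>; their sum is the absolute difference.\<close>

lemma TL_length_eq:
  "TL_length n X =
     (\<Sum>a=1..n. \<Sum>b=1..n. if a < b \<and> {Top a, Top b} \<in> X then b - a else 0) +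
     (\<Sum>a=1..n. \<Sum>b=1..n. if a < b \<and> {Bot a, Bot b} \<in> X then b - a else 0) +
     (\<Sum>a=1..n. \<Sum>c=1..n. if {Top a, Bot c} \<in> X then (a - c) + (c - a) else 0)"
proof -
  have comp: "length (concat [f a b. (a, b) \<leftarrow> ps]) = sum_list (map (\<lambda>(a, b). length (f a b)) ps)"
    for f :: "nat \<Rightarrow> nat \<Rightarrow> diagram list" and ps by (induction ps) auto
  have comp': "length (concat [f a b. (a, b) \<leftarrow> ps, P a b]) =
     sum_list (map (\<lambda>(a, b). if P a b then length (f a b) else 0) ps)"
    for f :: "nat \<Rightarrow> nat \<Rightarrow> diagram list" and ps P by (induction ps) auto
  have add: "(if P then x else 0) + (if P then y else 0) = (if P then x + y else (0::nat))" for P x y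
    by simp
  \<comment> \<open>Truncated subtraction absorbs the guard: \<open>c - a\<close> is 0 unless
    \<open>a < c\<close>.\<close>
  have EO: "(if a < c then length (E_list n a c @ O_list n a c) else 0) = c - a" for a c
    by (simp add: length_E_list_O_list)
  have "TL_length n X = sum_list (map (\<lambda>(a, b). b - a) (cups n X))
      + (sum_list (map (\<lambda>(a, c). c - a) (transversals n X)) + sum_list (map (\<lambda>(a, c). a - c) (transversals n X)))
      + sum_list (map (\<lambda>(a, b). b - a) (caps n X))"
    unfolding TL_length_def TL_word_def Let_def
    by (simp add: comp comp' EO[simplified] length_E_list_O_list add.commute[of "length (O_list _ _ _)"])
  moreover have transversal_sum:
    "(\<Sum>a=1..n. \<Sum>c=1..n. if {Top a, Bot c} \<in> X then a - c else 0) +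
     (\<Sum>a=1..n. \<Sum>c=1..n. if {Top a, Bot c} \<in> X then c - a else 0) =
     (\<Sum>a=1..n. \<Sum>c=1..n. if {Top a, Bot c} \<in> X then (a - c) + (c - a) else 0)"
    by (simp only: sum.distrib[symmetric] add)
  ultimately show ?thesis
    unfolding cups_def caps_def transversals_def sum_list_pairs transversal_sum[symmetric]
    by linarith
qed

text \<open>There are \<open>n - d\<close> pairs with difference \<open>d\<close>: passing from
  \<open>n\<close> to \<open>Suc n\<close> adds the pairs \<open>(a, Suc n)\<close>, in which each
  difference from 1 to \<open>n\<close> occurs once.\<close>

lemma sum_pairs_difference:
  fixes h :: "nat \<Rightarrow> nat"
  shows "(\<Sum>a=1..n. \<Sum>b=1..n. if a < b then h (b - a) else 0) = (\<Sum>d=1..n. (n - d) * h d)"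
proof (induction n)
  case (Suc n)
  have "(\<Sum>a=1..Suc n. \<Sum>b=1..Suc n. if a < b then h (b - a) else 0)
      = (\<Sum>a=1..n. (\<Sum>b=1..n. if a < b then h (b - a) else 0) + h (Suc n - a))"
    by (auto intro!: sum.cong sum.neutral)
  also have "\<dots> = (\<Sum>d=1..n. (n - d) * h d) + (\<Sum>a=1..n. h (Suc n - a))"
    using Suc by (simp add: sum.distrib)
  also have "(\<Sum>a=1..n. h (Suc n - a)) = (\<Sum>d=1..n. h d)"
    by (rule sum.reindex_bij_witness[of _ "\<lambda>d. Suc n - d" "\<lambda>d. Suc n - d"]) auto
  also have "(\<Sum>d=1..n. (n - d) * h d) + (\<Sum>d=1..n. h d) = (\<Sum>d=1..Suc n. (Suc n - d) * h d)"
    by (simp add: sum.distrib[symmetric] Suc_diff_le add.commute)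
  finally show ?case .
qed simp

text \<open>
  On the antidiagonal \<open>a + c = 2r\<close>, write \<open>a = r + t\<close> and \<open>c = r - t\<close>; then \<open>t\<close> ranges over
  \<open>-m, \<dots>, m\<close> with \<open>m = min (r - 1) (n - r)\<close>.
\<close>

lemma sum_even_antidiagonals:
  fixes G :: "nat \<Rightarrow> nat"
  assumes odd: "\<And>s. odd s \<Longrightarrow> s \<le> 2 * n \<Longrightarrow> G s = 0"
  shows "(\<Sum>a=1..n. \<Sum>c=1..n. ((a - c) + (c - a)) * G (a + c))
    = (\<Sum>r=1..n. 2 * (min (r - 1) (n - r) * (min (r - 1) (n - r) + 1)) * G (2 * r))"
proof -
  \<comment> \<open>Exchanging \<open>a\<close> and \<open>c\<close> shows that both truncated
    halves contribute equally, so only \<open>c < a\<close> has to be treated.\<close>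
  have "(\<Sum>a=1..n. \<Sum>c=1..n. (c - a) * G (a + c)) = (\<Sum>a=1..n. \<Sum>c=1..n. (a - c) * G (a + c))"
    by (subst sum.swap) (simp add: add.commute)
  then have "(\<Sum>a=1..n. \<Sum>c=1..n. ((a - c) + (c - a)) * G (a + c))
      = 2 * (\<Sum>a=1..n. \<Sum>c=1..n. (a - c) * G (a + c))"
    by (simp add: distrib_right sum.distrib)
  also have "(\<Sum>a=1..n. \<Sum>c=1..n. (a - c) * G (a + c))
      = (\<Sum>(a, c)\<in>{1..n} \<times> {1..n}. (a - c) * G (a + c))"
    by (rule sum.cartesian_product)
  also have "\<dots> = (\<Sum>(a, c)\<in>{(a, c). (a, c) \<in> {1..n} \<times> {1..n} \<and> c < a \<and> even (a + c)}. (a - c) * G (a + c))"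
    by (rule sum.mono_neutral_right) (use odd[of "a + c" for a c] in force)+
  also have "\<dots> = (\<Sum>(r, t)\<in>(SIGMA r:{1..n}. {1..min (r - 1) (n - r)}). 2 * t * G (2 * r))"
  proof (rule sum.reindex_bij_witness[of _ "\<lambda>(r, t). (r + t, r - t)" "\<lambda>(a, c). ((a + c) div 2, (a - c) div 2)"])
    fix p assume "p \<in> {(a, c). (a, c) \<in> {1..n} \<times> {1..n} \<and> c < a \<and> even (a + c)}"
    then obtain a c where p: "p = (a, c)" "1 \<le> c" "a \<le> n" "c < a" "even (a + c)" by auto
    then have "even (a - c)" by simp
    then obtain t where "a - c = 2 * t" by blast
    then have a: "a = c + 2 * t" "t \<ge> 1" using p(4) by auto
    have div: "(a + c) div 2 = c + t" "(a - c) div 2 = t" by (auto simp: a(1))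
    show "(case case p of (a, c) \<Rightarrow> ((a + c) div 2, (a - c) div 2) of (r, t) \<Rightarrow> (r + t, r - t)) = p"
      "(case p of (a, c) \<Rightarrow> ((a + c) div 2, (a - c) div 2)) \<in> (SIGMA r:{1..n}. {1..min (r - 1) (n - r)})"
      "(case case p of (a, c) \<Rightarrow> ((a + c) div 2, (a - c) div 2) of (r, t) \<Rightarrow> 2 * t * G (2 * r)) =
       (case p of (a, c) \<Rightarrow> (a - c) * G (a + c))"
      using p(2,3) a(2)
      by (simp_all add: p(1) div, simp_all add: a(1) mult_2 add_ac, arith)
  next
    fix q assume "q \<in> (SIGMA r:{1..n}. {1..min (r - 1) (n - r)})"
    then obtain r t where q: "q = (r, t)" "1 \<le> t" "t \<le> r - 1" "t \<le> n - r" "1 \<le> r" "r \<le> n" by auto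
    have "r + t + (r - t) = 2 * r" "r + t - (r - t) = 2 * t" using q by auto
    then show "(case case q of (r, t) \<Rightarrow> (r + t, r - t) of (a, c) \<Rightarrow> ((a + c) div 2, (a - c) div 2)) = q"
      "(case q of (r, t) \<Rightarrow> (r + t, r - t)) \<in> {(a, c). (a, c) \<in> {1..n} \<times> {1..n} \<and> c < a \<and> even (a + c)}"
      using q by (simp_all only: prod.case mem_Collect_eq) auto
  qed
  also have "\<dots> = (\<Sum>r=1..n. \<Sum>t=1..min (r - 1) (n - r). 2 * t * G (2 * r))"
    by (rule sum.Sigma[symmetric]) auto
  also have "\<dots> = (\<Sum>r=1..n. min (r - 1) (n - r) * (min (r - 1) (n - r) + 1) * G (2 * r))"
  proof (rule sum.cong)
    fix r
    have "(\<Sum>t=1..m. 2 * t) = m * (m + 1)" for m :: nat by (induction m) auto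
    then show "(\<Sum>t=1..min (r - 1) (n - r). 2 * t * G (2 * r))
        = min (r - 1) (n - r) * (min (r - 1) (n - r) + 1) * G (2 * r)"
      by (simp only: sum_distrib_right[symmetric])
  qed simp
  finally show ?thesis by (simp only: sum_distrib_left mult.assoc)
qed

section \<open>Total and average length\<close>

text \<open>After exchanging summations, each boundary pair contributes its column distance times
  the number of diagrams containing it. At boundary distance \<open>2 * k + 1\<close> each row has
  \<open>n - (2 * k + 1)\<close> pairs, all of column distance \<open>2 * k + 1\<close>; the pairs
  between the rows give the term with \<open>min\<close>.\<close>

lemma sum_TL_length:
  "(\<Sum>X\<in>TL n. TL_length n X) =
     (\<Sum>k<n. (2 * ((n - (2 * k + 1)) * (2 * k + 1)) + 2 * (min k (n - 1 - k) * (min k (n - 1 - k) + 1)))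
        * (nc_count (2 * k) * nc_count (2 * (n - 1 - k))))"
proof -
  define W where "W = pair_count n"
  have W_even: "W d = 0" if "even d" for d using that by (simp add: W_def pair_count_def)
  have W_odd: "W (2 * k + 1) = nc_count (2 * k) * nc_count (2 * (n - 1 - k))" for k
    by (simp add: W_def pair_count_def diff_mult_distrib2 algebra_simps)
  have swap: "(\<Sum>X\<in>TL n. \<Sum>a=1..n. \<Sum>b=1..n. if Q a b \<and> R a b \<in> X then w a b else 0)
      = (\<Sum>a=1..n. \<Sum>b=1..n. if Q a b then w a b * card {X \<in> TL n. R a b \<in> X} else 0)"
    for Q and R :: "nat \<Rightarrow> nat \<Rightarrow> vertex set" and w :: "nat \<Rightarrow> nat \<Rightarrow> nat"
  proof -
    have count: "(\<Sum>X\<in>TL n. if Q a b \<and> R a b \<in> X then w a b else 0)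
        = (if Q a b then w a b * card {X \<in> TL n. R a b \<in> X} else 0)" for a b
      by (simp add: finite_TL sum.If_cases Int_def mult.commute)
    have "(\<Sum>X\<in>TL n. \<Sum>a=1..n. \<Sum>b=1..n. if Q a b \<and> R a b \<in> X then w a b else 0)
        = (\<Sum>a=1..n. \<Sum>b=1..n. \<Sum>X\<in>TL n. if Q a b \<and> R a b \<in> X then w a b else 0)"
      by (rule trans[OF sum.swap]) (rule sum.cong[OF refl], rule sum.swap)
    then show ?thesis unfolding count .
  qed
  note swap_all = swap[where Q = "\<lambda>_ _. True", unfolded simp_thms if_True]
  have tops: "card {X \<in> TL n. {Top a, Top b} \<in> X} = W (b - a)"
    if "a \<in> {1..n}" "b \<in> {1..n}" "a < b" for a b
    using that card_TL_containing[of "Top a" n "Top b"] by (simp add: W_def vertices_def)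
  have bots: "card {X \<in> TL n. {Bot a, Bot b} \<in> X} = W (b - a)"
    if "a \<in> {1..n}" "b \<in> {1..n}" "a < b" for a b
  proof -
    \<comment> \<open>The bottom row is traversed from right to left, so \<open>Bot b\<close>
      precedes \<open>Bot a\<close>.\<close>
    have "(2 * n + 1 - a) - (2 * n + 1 - b) = b - a" using that by simp
    then show ?thesis
      using that card_TL_containing[of "Bot b" n "Bot a"]
      by (simp add: W_def vertices_def insert_commute image_iff)
  qed
  have trans: "card {X \<in> TL n. {Top a, Bot c} \<in> X} = W (2 * n + 1 - (a + c))"
    if "a \<in> {1..n}" "c \<in> {1..n}" for a c
  proof -
    have "2 * n + 1 - c - a = 2 * n + 1 - (a + c)" "a < 2 * n + 1 - c" using that by auto
    then show ?thesis
      using that card_TL_containing[of "Top a" n "Bot c"] by (simp add: W_def vertices_def)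
  qed
  have same_row: "(\<Sum>a=1..n. \<Sum>b=1..n. if a < b then (b - a) * W (b - a) else 0)
      = (\<Sum>k<n. (n - (2 * k + 1)) * (2 * k + 1) * W (2 * k + 1))"
  proof -
    have "(\<Sum>a=1..n. \<Sum>b=1..n. if a < b then (b - a) * W (b - a) else 0)
        = (\<Sum>d=1..n. (n - d) * (d * W d))"
      by (rule sum_pairs_difference)
    \<comment> \<open>The range can be changed freely: the term at 0 vanishes by the factor
      \<open>d\<close>, and those with \<open>d \<ge> n\<close> by the truncated
      \<open>n - d\<close>.\<close>
    also have "\<dots> = (\<Sum>d<2 * n. (n - d) * (d * W d))"
    proof (cases "n = 0")
      case False
      have "{1..n} - {..<2 * n} \<subseteq> {n}" by auto
      then show ?thesis by (intro sum.mono_neutral_cong) auto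
    qed simp
    also have "\<dots> = (\<Sum>k<n. (n - (2 * k + 1)) * ((2 * k + 1) * W (2 * k + 1)))"
      by (rule sum_nat_odd) (simp add: W_even)
    finally show ?thesis by (simp only: mult.assoc)
  qed
  have between_rows: "(\<Sum>a=1..n. \<Sum>c=1..n. ((a - c) + (c - a)) * W (2 * n + 1 - (a + c)))
      = (\<Sum>k<n. 2 * (min k (n - 1 - k) * (min k (n - 1 - k) + 1)) * W (2 * k + 1))"
  proof -
    have "(\<Sum>a=1..n. \<Sum>c=1..n. ((a - c) + (c - a)) * W (2 * n + 1 - (a + c)))
      = (\<Sum>r=1..n. 2 * (min (r - 1) (n - r) * (min (r - 1) (n - r) + 1)) * W (2 * n + 1 - 2 * r))"
      by (rule sum_even_antidiagonals) (simp add: W_even)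
    also have "\<dots> = (\<Sum>k<n. 2 * (min k (n - 1 - k) * (min k (n - 1 - k) + 1)) * W (2 * k + 1))"
    \<comment> \<open>With \<open>r = n - k\<close> the boundary distance
      \<open>2 * n + 1 - 2 * r\<close> becomes \<open>2 * k + 1\<close>.\<close>
    proof (rule sum.reindex_bij_witness[of _ "\<lambda>k. n - k" "\<lambda>r. n - r"])
      fix r assume r: "r \<in> {1..n}"
      have "2 * (n - r) + 1 = 2 * n + 1 - 2 * r" using r by auto
      moreover have "n - 1 - (n - r) = r - 1" using r by auto
      ultimately show "2 * (min (n - r) (n - 1 - (n - r)) * (min (n - r) (n - 1 - (n - r)) + 1)) * W (2 * (n - r) + 1)
         = 2 * (min (r - 1) (n - r) * (min (r - 1) (n - r) + 1)) * W (2 * n + 1 - 2 * r)"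
        by (simp only: min.commute)
    qed auto
    finally show ?thesis .
  qed
  have "(\<Sum>X\<in>TL n. TL_length n X) =
      (\<Sum>a=1..n. \<Sum>b=1..n. if a < b then (b - a) * W (b - a) else 0) +
      (\<Sum>a=1..n. \<Sum>b=1..n. if a < b then (b - a) * W (b - a) else 0) +
      (\<Sum>a=1..n. \<Sum>c=1..n. ((a - c) + (c - a)) * W (2 * n + 1 - (a + c)))"
    unfolding TL_length_eq sum.distrib swap swap_all
    by (intro arg_cong2[where f = "(+)"] sum.cong refl) (simp_all add: tops bots trans)
  also have "\<dots> = (\<Sum>k<n. (2 * ((n - (2 * k + 1)) * (2 * k + 1))
        + 2 * (min k (n - 1 - k) * (min k (n - 1 - k) + 1))) * W (2 * k + 1))"
    unfolding same_row between_rows by (simp add: sum.distrib[symmetric] algebra_simps)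
  finally show ?thesis unfolding W_odd .
qed

text \<open>Writing the larger number as the smaller plus \<open>j\<close> removes
  \<open>min\<close> and the truncated subtractions and leaves a polynomial identity.\<close>

lemma symmetrized_weight:
  fixes k l :: nat
  shows "2 * ((l - k) * (2 * k + 1)) + 2 * (min k l * (min k l + 1)) +
     (2 * ((k - l) * (2 * l + 1)) + 2 * (min l k * (min l k + 1))) = 2 * (2 * k * l + k + l)"
proof (cases "k \<le> l")
  case True
  then obtain j where "l = k + j" using le_Suc_ex by blast
  then show ?thesis by (simp add: algebra_simps)
next
  case False
  then obtain j where "k = l + j" using le_Suc_ex[of l k] by auto
  then show ?thesis by (simp add: algebra_simps)
qed

text \<open>The product of counts is invariant under exchanging \<open>k\<close> and
  \<open>m - k\<close>, so the weight may be averaged over this exchange; the doubled sum avoids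
  halving.\<close>

lemma sum_TL_length_symmetric:
  "(\<Sum>X\<in>TL (Suc m). TL_length (Suc m) X) =
     (\<Sum>k\<le>m. (2 * k * (m - k) + k + (m - k)) * (nc_count (2 * k) * nc_count (2 * (m - k))))"
proof -
  let ?A = "\<lambda>k l. 2 * ((l - k) * (2 * k + 1)) + 2 * (min k l * (min k l + 1)) :: nat"
  let ?C = "\<lambda>k. nc_count (2 * k)"
  have S: "(\<Sum>X\<in>TL (Suc m). TL_length (Suc m) X) = (\<Sum>k\<le>m. ?A k (m - k) * (?C k * ?C (m - k)))"
  proof -
    have "Suc m - (2 * k + 1) = m - k - k" for k by simp
    then show ?thesis unfolding sum_TL_length lessThan_Suc_atMost by (intro sum.cong refl) simp
  qed
  moreover have "(\<Sum>k\<le>m. ?A k (m - k) * (?C k * ?C (m - k))) = (\<Sum>k\<le>m. ?A (m - k) k * (?C k * ?C (m - k)))"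
    by (rule sum.reindex_bij_witness[of _ "\<lambda>k. m - k" "\<lambda>k. m - k"]) auto
  ultimately have "2 * (\<Sum>X\<in>TL (Suc m). TL_length (Suc m) X) =
      (\<Sum>k\<le>m. ?A k (m - k) * (?C k * ?C (m - k))) + (\<Sum>k\<le>m. ?A (m - k) k * (?C k * ?C (m - k)))"
    by linarith
  also have "\<dots> = (\<Sum>k\<le>m. (?A k (m - k) + ?A (m - k) k) * (?C k * ?C (m - k)))"
    by (rule trans[OF sum.distrib[symmetric]]) (rule sum.cong[OF refl], rule distrib_right[symmetric])
  also have "\<dots> = 2 * (\<Sum>k\<le>m. (2 * k * (m - k) + k + (m - k)) * (?C k * ?C (m - k)))"
    unfolding symmetrized_weight by (simp only: sum_distrib_left mult.assoc)
  finally show ?thesis by simp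
qed

text \<open>With \<open>l = m - k\<close>, twice the weight is
  \<open>(2 * k + 1) * (2 * l + 1) - 1\<close>. The product part becomes a convolution of shifted
  central binomial coefficients, and the \<open>- 1\<close> sums to a Catalan number by the
  recurrence.\<close>

lemma sum_TL_length_closed_form:
  assumes "n \<ge> 1"
  shows "(\<Sum>X\<in>TL n. real (TL_length n X)) = 2 ^ (2 * n - 1) - real ((2 * n) choose n)"
proof -
  obtain m where n: "n = Suc m" using assms by (cases n) auto
  let ?b = "\<lambda>k. real ((2 * k) choose k)"
  let ?c = "\<lambda>k. real (nc_count (2 * k))"
  have c: "real (2 * k + 1) * ?c k = ?b (Suc k) / 2" for k
    using central_binomial_Suc[of k] unfolding nc_count_even by (simp add: field_simps)
  have rec: "?c n = (\<Sum>k\<le>m. ?c k * ?c (m - k))"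
    by (simp only: n nc_count_rec of_nat_sum of_nat_mult)
  have S: "(\<Sum>X\<in>TL n. real (TL_length n X)) =
      (\<Sum>k\<le>m. real (2 * k * (m - k) + k + (m - k)) * (?c k * ?c (m - k)))"
    using arg_cong[OF sum_TL_length_symmetric[of m], of real]
    by (simp only: n of_nat_sum of_nat_mult)
  have "2 * (\<Sum>X\<in>TL n. real (TL_length n X)) =
      (\<Sum>k\<le>m. 2 * real (2 * k * (m - k) + k + (m - k)) * (?c k * ?c (m - k)))"
    unfolding S by (simp only: sum_distrib_left mult.assoc)
  also have "\<dots> = (\<Sum>k\<le>m. (real (2 * k + 1) * ?c k) * (real (2 * (m - k) + 1) * ?c (m - k)) - ?c k * ?c (m - k))"
  proof (intro sum.cong refl)
    fix k assume "k \<in> {..m}"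
    then obtain l where l: "m = k + l" by (auto dest: le_Suc_ex)
    show "2 * real (2 * k * (m - k) + k + (m - k)) * (?c k * ?c (m - k)) =
        (real (2 * k + 1) * ?c k) * (real (2 * (m - k) + 1) * ?c (m - k)) - ?c k * ?c (m - k)"
      unfolding l add_diff_cancel_left' by (simp add: algebra_simps)
  qed
  also have "\<dots> = (\<Sum>k\<le>m. ?b (Suc k) * ?b (Suc (m - k))) / 4 - ?c n"
    unfolding c rec by (simp add: sum_subtractf sum_divide_distrib)
  also have "(\<Sum>k\<le>m. ?b (Suc k) * ?b (Suc (m - k))) = 4 ^ Suc n - 2 * ?b (Suc n)"
  proof -
    \<comment> \<open>The end terms \<open>k = 0\<close> and \<open>k = Suc n\<close> of the full
      convolution each equal \<open>?b (Suc n)\<close>; the interior is the wanted sum.\<close>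
    have "4 ^ Suc n = (\<Sum>k\<le>Suc n. ?b k * ?b (Suc n - k))"
      by (rule sum_central_binomial_convolution[symmetric])
    also have "\<dots> = ?b (Suc n) + (\<Sum>k\<le>n. ?b (Suc k) * ?b (n - k))"
      by (subst sum.atMost_Suc_shift) simp
    also have "(\<Sum>k\<le>n. ?b (Suc k) * ?b (n - k)) = ?b (Suc n) + (\<Sum>k\<le>m. ?b (Suc k) * ?b (n - k))"
      unfolding n by simp
    also have "(\<Sum>k\<le>m. ?b (Suc k) * ?b (n - k)) = (\<Sum>k\<le>m. ?b (Suc k) * ?b (Suc (m - k)))"
      by (intro sum.cong refl) (simp add: n Suc_diff_le)
    finally show ?thesis by simp
  qed
  \<comment> \<open>Turning \<open>?b (Suc n) / 2\<close> back into
    \<open>real (2 * n + 1) * ?c n\<close> lets the multiples of \<open>?c n\<close> combine to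
    \<open>2 * ?b n\<close>.\<close>
  also have "(4 ^ Suc n - 2 * ?b (Suc n)) / 4 - ?c n = 4 ^ n - (real (2 * n + 1) * ?c n) - ?c n"
    unfolding c by (simp add: field_simps)
  also have "\<dots> = 4 ^ n - 2 * (real (Suc n) * ?c n)" by (simp add: algebra_simps)
  also have "real (Suc n) * ?c n = ?b n" unfolding nc_count_even by simp
  also have "(4 :: real) ^ n = 2 * 2 ^ (2 * n - 1)"
    using assms by (simp add: power_mult flip: power_Suc)
  finally show ?thesis by simp
qed

section \<open>Averages and the asymptotic runtime\<close>

lemma avg_length_eq:
  assumes "n \<ge> 1"
  shows "avg_length n =
    (real n + 1) * (2 ^ (2 * n - 1) - real ((2 * n) choose n)) / real ((2 * n) choose n)"
  unfolding avg_length_def sum_TL_length_closed_form[OF assms] card_TL nc_count_even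
  by (simp add: add.commute)

lemma avg_runtime_eq_avg_length: "avg_runtime n = 2 * real n + 2 * avg_length n"
proof -
  have "real (card (TL n)) > 0"
    unfolding card_TL nc_count_even by simp
  then show ?thesis
    by (simp add: avg_runtime_def avg_length_def TL_steps_def sum.distrib sum_distrib_left[symmetric] field_simps)
qed

text \<open>The subtracted binomial in \<open>avg_length\<close> contributes
  \<open>- 2 * (n + 1)\<close>, which together with \<open>2 * n\<close> leaves
  \<open>- 2\<close>.\<close>

lemma avg_runtime_eq:
  assumes "n \<ge> 1"
  shows "avg_runtime n = 2 ^ (2 * n) * (real n + 1) / real ((2 * n) choose n) - 2"
proof -
  have "(2 :: real) ^ (2 * n) = 2 * 2 ^ (2 * n - 1)" using assms by (simp flip: power_Suc)
  moreover have "real ((2 * n) choose n) > 0" by simp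
  ultimately show ?thesis
    unfolding avg_runtime_eq_avg_length avg_length_eq[OF assms] by (simp add: field_simps)
qed

text \<open>Inserting the asymptotics of the central binomial coefficient cancels
  \<open>4 ^ n\<close> and leaves \<open>n * sqrt (pi * n)\<close>; the constant \<open>- 2\<close>
  is of lower order.\<close>

lemma avg_runtime_asymp_equiv: "avg_runtime \<sim>[at_top] (\<lambda>n. sqrt pi * real n powr (3 / 2))"
proof -
  have "(\<lambda>n. 2 ^ (2 * n) * (real n + 1) / real ((2 * n) choose n))
      \<sim>[at_top] (\<lambda>n. 2 ^ (2 * n) * real n / (4 ^ n / sqrt (pi * real n)))"
  proof (intro asymp_equiv_intros central_binomial_asymp_equiv)
    show "(\<lambda>n. real n + 1) \<sim>[at_top] real" by real_asymp
  qed
  also have "eventually (\<lambda>n. 2 ^ (2 * n) * real n / (4 ^ n / sqrt (pi * real n))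
      = sqrt pi * real n powr (3 / 2)) at_top"
    using eventually_gt_at_top[of "0::nat"]
  proof eventually_elim
    case (elim n)
    have "real n powr (3 / 2) = real n powr 1 * real n powr (1 / 2)"
      by (subst powr_add[symmetric]) simp
    also have "\<dots> = real n * sqrt (real n)" by (simp add: powr_half_sqrt)
    finally show ?case by (simp add: power_mult real_sqrt_mult)
  qed
  finally have main: "(\<lambda>n. 2 ^ (2 * n) * (real n + 1) / real ((2 * n) choose n))
      \<sim>[at_top] (\<lambda>n. sqrt pi * real n powr (3 / 2))" .
  have "(\<lambda>n. - 2) \<in> o[at_top](\<lambda>n :: nat. sqrt pi * real n powr (3 / 2))" by real_asymp
  then have "(\<lambda>n. 2 ^ (2 * n) * (real n + 1) / real ((2 * n) choose n) + - 2)
      \<sim>[at_top] (\<lambda>n. sqrt pi * real n powr (3 / 2))"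
    using main by (rule asymp_equiv_add_right[THEN iffD2])
  then show ?thesis
  proof (rule asymp_equiv_cong[THEN iffD1, rotated 2])
    show "\<forall>\<^sub>F n in at_top. 2 ^ (2 * n) * (real n + 1) / real ((2 * n) choose n) + - 2 = avg_runtime n"
      using eventually_ge_at_top[of "1::nat"] by eventually_elim (simp add: avg_runtime_eq)
  qed simp
qed

theorem proposition3p1p5:
  shows "(\<forall>n::nat. n \<ge> 2 \<longrightarrow>
            avg_length n =
              (real n + 1) * (2 ^ (2 * n - 1) - real ((2 * n) choose n)) / real ((2 * n) choose n) \<and>
            avg_runtime n = 2 ^ (2 * n) * (real n + 1) / real ((2 * n) choose n) - 2) \<and>
         avg_runtime \<sim>[at_top] (\<lambda>n. sqrt pi * real n powr (3 / 2))"
  by (intro conjI allI impI avg_length_eq avg_runtime_eq avg_runtime_asymp_equiv) linarith+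

end
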